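(* Let $\mu>0$ and suppose $f:\mathcal{X}\to\mathbb{R}$ is $\mu$-strongly-convex and $(r,\ell)$-smooth. Let $x_0\in\mathcal{X}$, denote $G:=\|\nabla f(x_0)\|$ and $L:=\ell(G)$, and let $0<\eta\le\min\left\{\frac{1}{L},\frac{r(G)}{2G}\right\}$. Then the gradient descent iterates $x_{t+1}=x_t-\eta\nabla f(x_t)$ satisfy $\|\nabla f(x_t)\|\le G$ for all $t\ge 0$, and for every integer $T\ge 1$ $$f(x_T)-f^*\le\frac{\mu(1-\eta\mu)^T}{2\left(1-(1-\eta\mu)^T\right)}\|x_0-x^*\|^2.$$
   Context: $\mathcal{X}\subseteq\mathbb{R}^d$ ($d\ge1$) is the domain of $f$; $\|\cdot\|$ is the Euclidean norm. Standing assumptions: (1) $\mathcal{X}$ is open, $f$ is differentiable on $\mathcal{X}$ and closed, i.e. for each $a\in\mathbb{R}$ the sub-level set $\{x\in\mathcal{X}: f(x)\le a\}$ is closed (in $\mathbb{R}^d$); (2) $f^*:=\inf_{x\in\mathcal{X}}f(x)>-\infty$; (3) there is a point $x^*\in\mathcal{X}$ with $f(x^* )=f^*$. Strong convexity: $f$ is $\mu$-strongly-convex if $\mathcal{X}$ is a convex set and $f(y)-f(x)\ge\langle\nabla f(x),y-x\rangle+\frac{\mu}{2}\|y-x\|^2$ for all $x,y\in\mathcal{X}$. $(r,\ell)$-smoothness: let $r,\ell:[0,+\infty)\to(0,+\infty)$ be continuous, with $\ell$ non-decreasing and $r$ non-increasing, and let $\mathcal{B}(x,R)$ be the closed Euclidean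 ball of radius $R$ centered at $x$. A differentiable $f:\mathcal{X}\to\mathbb{R}$ is $(r,\ell)$-smooth if 1) for any $x\in\mathcal{X}$, $\mathcal{B}(x,r(\|\nabla f(x)\|))\subseteq\mathcal{X}$, and 2) for any $x\in\mathcal{X}$ and any $x_1,x_2\in\mathcal{B}(x,r(\|\nabla f(x)\|))$, $\|\nabla f(x_1)-\nabla f(x_2)\|\le\ell(\|\nabla f(x)\|)\cdot\|x_1-x_2\|$. Conventions: $r(G)/(2G)=+\infty$ if $G=0$. The assertion about the iterates includes that they remain in $\mathcal{X}$, so that the recursion is well defined. *)

theory Defs
  imports "HOL-Analysis.Analysis"
begin

text \<open>
  A function \<open>f : X \<rightarrow> \<real>\<close> is represented by a total function of which only the
  values on \<open>X\<close> matter. Since \<open>X\<close> is always open below, derivatives at points of \<open>X\<close>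
  do not depend on the extension. \<open>grad f x\<close> is meaningful only where \<open>f\<close> is differentiable.
\<close>

definition grad :: "('a::euclidean_space \<Rightarrow> real) \<Rightarrow> 'a \<Rightarrow> 'a" where
  "grad f x = (THE D. GDERIV f x :> D)"

lemma grad_eqI:
  assumes "GDERIV f x :> D"
  shows "grad f x = D"
  unfolding grad_def
proof (rule the_equality)
  show "GDERIV f x :> D" by (fact assms)
next
  fix E assume "GDERIV f x :> E"
  then have "(\<lambda>h. h \<bullet> E) = (\<lambda>h. h \<bullet> D)"
    using assms unfolding gderiv_def by (rule has_derivative_unique)
  then show "E = D"
    by (metis vector_eq_ldot)
qed

lemma GDERIV_grad:
  assumes "f differentiable (at x)"
  shows "GDERIV f x :> grad f x"
proof -
  obtain f' where f': "(f has_derivative f') (at x)"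
    using assms unfolding differentiable_def by blast
  then interpret linear f' by (rule has_derivative_linear)
  have "f' h = h \<bullet> adjoint f' 1" for h
    using adjoint_works[OF linear_axioms, of h 1] by simp
  then have "f' = (\<lambda>h. h \<bullet> adjoint f' 1)" by blast
  with f' have "GDERIV f x :> adjoint f' 1" unfolding gderiv_def by simp
  then show ?thesis using grad_eqI by metis
qed

definition strongly_convex_on :: "real \<Rightarrow> 'a::euclidean_space set \<Rightarrow> ('a \<Rightarrow> real) \<Rightarrow> bool" where
  "strongly_convex_on \<mu> X f \<longleftrightarrow>
     convex X \<and>
     (\<forall>x\<in>X. \<forall>y\<in>X. f y - f x \<ge> grad f x \<bullet> (y - x) + \<mu> / 2 * (norm (y - x))\<^sup>2)"

definition rl_smooth_on ::
  "(real \<Rightarrow> real) \<Rightarrow> (real \<Rightarrow> real) \<Rightarrow> 'a::euclidean_space set \<Rightarrow> ('a \<Rightarrow> real) \<Rightarrow> bool" where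
  "rl_smooth_on r l X f \<longleftrightarrow>
     (\<forall>x\<in>X. f differentiable (at x)) \<and>
     (\<forall>x\<in>X. cball x (r (norm (grad f x))) \<subseteq> X) \<and>
     (\<forall>x\<in>X. \<forall>x1\<in>cball x (r (norm (grad f x))). \<forall>x2\<in>cball x (r (norm (grad f x))).
        norm (grad f x1 - grad f x2) \<le> l (norm (grad f x)) * norm (x1 - x2))"

end

theory Submission
  imports Defs
begin

text \<open>
  Two facts about one gradient step carry the proof, and both are local: smoothness enters through
  the gradient being \<open>L\<close>-Lipschitz on the ball of radius \<open>R = r (norm (grad f x))\<close> around the current
  point \<open>x\<close>.

  The first is that the gradient norm does not increase. The step size keeps the new point \<open>y\<close>
  within distance \<open>R / 2\<close> of \<open>x\<close>, and this margin is enough for the auxiliary points in the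
  classical proof of cocoercivity to lie in the full ball, so that
  \<open>(norm (g x - g y))\<^sup>2 \<le> L * ((g x - g y) \<bullet> (x - y))\<close> already follows from smoothness on that
  ball (\<open>cocoercive_in_ball\<close>), where \<open>g\<close> is the gradient of \<open>f\<close>. Inserting
  \<open>x - y = \<eta> *\<^sub>R g x\<close> and \<open>L * \<eta> \<le> 1\<close> gives \<open>norm (g y) \<le> norm (g x)\<close>
  (\<open>gradient_step_norm_le\<close>). As \<open>r\<close> is non-increasing and \<open>l\<close> non-decreasing, a gradient norm
  of at most \<open>G\<close> means a radius of at least \<open>r G\<close> and a Lipschitz constant of at most \<open>L\<close>; thus
  the same step size remains admissible and the bound \<open>G\<close> propagates along the iteration.

  The second is the sufficient decrease \<open>f y \<le> f x - \<eta> / 2 * (norm (g x))\<^sup>2\<close>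
  (\<open>gradient_step_decrease\<close>). Expanding the squared distance to the minimiser, strong convexity
  bounds the cross term, and the decrease absorbs the remaining \<open>\<eta>\<^sup>2 * (norm (g x))\<^sup>2\<close>. With
  \<open>q = 1 - \<eta> * \<mu>\<close>, \<open>d\<close> the squared distance and \<open>\<delta>\<close> the objective gap, this reads
  \<open>d (Suc t) \<le> q * d t - 2 * \<eta> * \<delta> (Suc t)\<close> (\<open>gradient_step_contraction\<close>). Unrolling it with
  \<open>\<delta>\<close> non-increasing produces a geometric sum in front of the last gap, whence the rate
  (\<open>gap_bound_of_contraction\<close>).
\<close>

section \<open>Functions with Lipschitz gradient on a convex set\<close>

text \<open>
  The restriction to the segment, minus its claimed quadratic majorant, has a non-positive
  derivative by the Lipschitz bound between \<open>y\<close> and the points of the segment.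
\<close>
lemma lipschitz_gradient_quadratic_upper_bound:
  fixes f :: "'a::euclidean_space \<Rightarrow> real"
  assumes S: "convex S" and lip: "L-lipschitz_on S g"
    and deriv: "\<And>x. x \<in> S \<Longrightarrow> GDERIV f x :> g x"
    and y: "y \<in> S" and z: "z \<in> S"
  shows "f z \<le> f y + g y \<bullet> (z - y) + L / 2 * (norm (z - y))\<^sup>2"
proof -
  define p where "p t = y + t *\<^sub>R (z - y)" for t :: real
  define \<phi> where "\<phi> t = f (p t) - t * (g y \<bullet> (z - y)) - L / 2 * t\<^sup>2 * (norm (z - y))\<^sup>2" for t
  have "\<phi> 1 \<le> \<phi> 0"
  proof (rule DERIV_nonpos_imp_nonincreasing[where f = \<phi>])
    fix t :: real assume t: "0 \<le> t" "t \<le> 1"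
    have "p t = (1 - t) *\<^sub>R y + t *\<^sub>R z"
      by (simp add: p_def algebra_simps)
    then have pt: "p t \<in> S"
      using S y z t by (simp add: convexD)
    have dp: "(p has_derivative (\<lambda>h. h *\<^sub>R (z - y))) (at t)"
      unfolding p_def by (auto intro!: derivative_eq_intros)
    have df: "(f has_derivative (\<lambda>h. h \<bullet> g (p t))) (at (p t))"
      using deriv[OF pt] by (simp add: gderiv_def)
    have "((\<lambda>t. f (p t)) has_derivative (\<lambda>h. (h *\<^sub>R (z - y)) \<bullet> g (p t))) (at t)"
      using has_derivative_compose[OF dp df] .
    then have dfp: "((\<lambda>t. f (p t)) has_real_derivative ((z - y) \<bullet> g (p t))) (at t)"
      by (simp add: has_field_derivative_def mult_commute_abs)
    have d\<phi>: "(\<phi> has_real_derivative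
        ((z - y) \<bullet> g (p t) - g y \<bullet> (z - y) - L * t * (norm (z - y))\<^sup>2)) (at t)"
      unfolding \<phi>_def by (auto intro!: derivative_eq_intros dfp)
    have "(z - y) \<bullet> g (p t) - g y \<bullet> (z - y) = (g (p t) - g y) \<bullet> (z - y)"
      by (simp only: inner_diff_left[of "g (p t)"] inner_commute[of "z - y"])
    also have "\<dots> \<le> norm (g (p t) - g y) * norm (z - y)"
      by (rule norm_cauchy_schwarz)
    also have "\<dots> \<le> (L * norm (p t - y)) * norm (z - y)"
      using lipschitz_onD[OF lip pt y] by (simp add: dist_norm mult_right_mono)
    also have "\<dots> = L * t * (norm (z - y))\<^sup>2"
      using t by (simp add: p_def power2_eq_square)
    finally show "\<exists>D. (\<phi> has_real_derivative D) (at t) \<and> D \<le> 0"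
      using d\<phi> by auto
  qed simp
  then show ?thesis by (simp add: \<phi>_def p_def)
qed

text \<open>
  One half of cocoercivity: compare the convex lower bound at \<open>x\<close> and the quadratic upper bound
  at \<open>y\<close> in the point where their difference is smallest. With smoothness known only on \<open>S\<close>, that
  point has to lie in \<open>S\<close>.
\<close>
lemma convex_lipschitz_gradient_gap:
  fixes f :: "'a::euclidean_space \<Rightarrow> real"
  assumes S: "convex S" and lip: "L-lipschitz_on S g" and L: "L > 0"
    and deriv: "\<And>x. x \<in> S \<Longrightarrow> GDERIV f x :> g x"
    and conv: "\<And>x y. x \<in> S \<Longrightarrow> y \<in> S \<Longrightarrow> g x \<bullet> (y - x) \<le> f y - f x"
    and x: "x \<in> S" and y: "y \<in> S"
    and z: "y - (1 / L) *\<^sub>R (g y - g x) \<in> S"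
  shows "f x + g x \<bullet> (y - x) + (norm (g y - g x))\<^sup>2 / (2 * L) \<le> f y"
proof -
  define D where "D = g y - g x"
  define z where "z = y - (1 / L) *\<^sub>R D"
  have zS: "z \<in> S" using z by (simp add: z_def D_def)
  have "f x + g x \<bullet> (z - x) \<le> f y + g y \<bullet> (z - y) + L / 2 * (norm (z - y))\<^sup>2"
    using conv[OF x zS] lipschitz_gradient_quadratic_upper_bound[OF S lip deriv y zS] by simp
  moreover have "z - y = - ((1 / L) *\<^sub>R D)" by (simp add: z_def)
  moreover have "g x \<bullet> (z - x) = g x \<bullet> (y - x) - (1 / L) * (g x \<bullet> D)"
    by (simp add: z_def inner_diff_right)
  moreover have "L / 2 * (norm (- ((1 / L) *\<^sub>R D)))\<^sup>2 = (norm D)\<^sup>2 / (2 * L)"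
    using L by (simp add: power2_eq_square)
  moreover have "(1 / L) * (g y \<bullet> D) - (1 / L) * (g x \<bullet> D) = 2 * ((norm D)\<^sup>2 / (2 * L))"
    by (simp add: D_def power2_norm_eq_inner inner_diff_left diff_divide_distrib)
  ultimately show ?thesis by (simp add: D_def)
qed

text \<open>
  A ball of twice the distance is enough: each auxiliary point differs from its base point by
  \<open>norm (g x - g y) / L \<le> norm (x - y)\<close>, so it stays within \<open>2 * norm (x - y) \<le> R\<close> of the centre.
\<close>
lemma cocoercive_in_ball:
  fixes f :: "'a::euclidean_space \<Rightarrow> real"
  assumes lip: "L-lipschitz_on (cball x R) g" and L: "L > 0"
    and deriv: "\<And>u. u \<in> cball x R \<Longrightarrow> GDERIV f u :> g u"
    and conv: "\<And>u v. u \<in> cball x R \<Longrightarrow> v \<in> cball x R \<Longrightarrow> g u \<bullet> (v - u) \<le> f v - f u"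
    and y: "norm (x - y) \<le> R / 2"
  shows "(norm (g x - g y))\<^sup>2 \<le> L * ((g x - g y) \<bullet> (x - y))"
proof -
  have R: "0 \<le> R" using y norm_ge_zero[of "x - y"] by linarith
  have xB: "x \<in> cball x R" using R by simp
  have yB: "y \<in> cball x R" using y R by (simp add: dist_norm)
  have "norm (g x - g y) \<le> L * norm (x - y)"
    using lipschitz_onD[OF lip xB yB] by (simp add: dist_norm)
  then have "norm ((1 / L) *\<^sub>R (g x - g y)) \<le> norm (x - y)"
    using L by (simp add: pos_divide_le_eq mult.commute)
  then have shift: "norm ((1 / L) *\<^sub>R (g x - g y)) \<le> R / 2"
    using y by (rule order_trans)
  have "x - (y - (1 / L) *\<^sub>R (g y - g x)) = (x - y) - (1 / L) *\<^sub>R (g x - g y)"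
    by (simp add: algebra_simps)
  then have "norm (x - (y - (1 / L) *\<^sub>R (g y - g x)))
      \<le> norm (x - y) + norm ((1 / L) *\<^sub>R (g x - g y))"
    by (simp only: norm_triangle_ineq4)
  also have "\<dots> \<le> R" using y shift by linarith
  finally have zy: "y - (1 / L) *\<^sub>R (g y - g x) \<in> cball x R"
    by (simp add: dist_norm)
  have zx: "x - (1 / L) *\<^sub>R (g x - g y) \<in> cball x R"
    using order_trans[OF shift, of R] R by (simp add: dist_norm)
  have gap: "f u + g u \<bullet> (v - u) + (norm (g v - g u))\<^sup>2 / (2 * L) \<le> f v"
    if "u \<in> cball x R" "v \<in> cball x R" "v - (1 / L) *\<^sub>R (g v - g u) \<in> cball x R" for u v
    using convex_cball lip L deriv conv that by (rule convex_lipschitz_gradient_gap)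
  have "f x + g x \<bullet> (y - x) + (norm (g y - g x))\<^sup>2 / (2 * L) \<le> f y"
    by (rule gap[OF xB yB zy])
  moreover have "f y + g y \<bullet> (x - y) + (norm (g x - g y))\<^sup>2 / (2 * L) \<le> f x"
    by (rule gap[OF yB xB zx])
  moreover have "g x \<bullet> (y - x) + g y \<bullet> (x - y) = - ((g x - g y) \<bullet> (x - y))"
    by (simp add: inner_diff_left inner_diff_right)
  moreover have "(norm (g x - g y))\<^sup>2 / (2 * L) + (norm (g y - g x))\<^sup>2 / (2 * L)
      = (norm (g x - g y))\<^sup>2 / L"
    by (simp add: norm_minus_commute)
  ultimately have "(norm (g x - g y))\<^sup>2 / L \<le> (g x - g y) \<bullet> (x - y)"
    by linarith
  then show ?thesis using L by (simp add: divide_le_eq mult.commute)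
qed

section \<open>A single gradient step\<close>

lemma gradient_step_norm_le:
  fixes f :: "'a::euclidean_space \<Rightarrow> real"
  assumes lip: "L-lipschitz_on (cball x R) g" and L: "L > 0"
    and deriv: "\<And>u. u \<in> cball x R \<Longrightarrow> GDERIV f u :> g u"
    and conv: "\<And>u v. u \<in> cball x R \<Longrightarrow> v \<in> cball x R \<Longrightarrow> g u \<bullet> (v - u) \<le> f v - f u"
    and \<eta>: "0 < \<eta>" "\<eta> \<le> 1 / L" "\<eta> * norm (g x) \<le> R / 2"
  shows "norm (g (x - \<eta> *\<^sub>R g x)) \<le> norm (g x)"
proof -
  define y where "y = x - \<eta> *\<^sub>R g x"
  define D where "D = g x - g y"
  have step: "x - y = \<eta> *\<^sub>R g x" by (simp add: y_def)
  have "norm (x - y) \<le> R / 2" using \<eta> by (simp add: step)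
  from cocoercive_in_ball[OF lip L deriv conv this]
  have "(norm D)\<^sup>2 \<le> (L * \<eta>) * (D \<bullet> g x)"
    by (simp add: D_def step)
  moreover have "L * \<eta> \<le> 1" using \<eta> L by (simp add: field_simps)
  moreover have "0 \<le> D \<bullet> g x"
  proof -
    have "0 \<le> (L * \<eta>) * (D \<bullet> g x)"
      using calculation(1) zero_le_power2[of "norm D"] by linarith
    moreover have "0 < L * \<eta>" using L \<eta>(1) by simp
    ultimately show ?thesis by (simp only: zero_le_mult_iff) linarith
  qed
  ultimately have "(norm D)\<^sup>2 \<le> D \<bullet> g x"
    using mult_right_mono[of "L * \<eta>" 1 "D \<bullet> g x"] by linarith
  moreover have "(norm (g y))\<^sup>2 = (norm (g x))\<^sup>2 - 2 * (D \<bullet> g x) + (norm D)\<^sup>2"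
    by (simp add: D_def power2_norm_eq_inner inner_diff_left inner_diff_right inner_commute)
  ultimately have "(norm (g y))\<^sup>2 \<le> (norm (g x))\<^sup>2"
    using zero_le_power2[of "norm D"] by linarith
  then have "norm (g y) \<le> norm (g x)"
    by (rule power2_le_imp_le) simp
  then show ?thesis by (simp add: y_def)
qed

lemma gradient_step_decrease:
  fixes f :: "'a::euclidean_space \<Rightarrow> real"
  assumes S: "convex S" and lip: "L-lipschitz_on S g" and L: "L > 0"
    and deriv: "\<And>u. u \<in> S \<Longrightarrow> GDERIV f u :> g u"
    and \<eta>: "0 < \<eta>" "\<eta> \<le> 1 / L"
    and x: "x \<in> S" and y: "x - \<eta> *\<^sub>R g x \<in> S"
  shows "f (x - \<eta> *\<^sub>R g x) \<le> f x - \<eta> / 2 * (norm (g x))\<^sup>2"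
proof -
  have "f (x - \<eta> *\<^sub>R g x) \<le> f x - \<eta> * (norm (g x))\<^sup>2 + (L * \<eta>) * (\<eta> / 2 * (norm (g x))\<^sup>2)"
    using lipschitz_gradient_quadratic_upper_bound[OF S lip deriv x y]
    by (simp add: power2_norm_eq_inner power_mult_distrib) (simp add: power2_eq_square algebra_simps)
  also have "(L * \<eta>) * (\<eta> / 2 * (norm (g x))\<^sup>2) \<le> \<eta> / 2 * (norm (g x))\<^sup>2"
    using L \<eta> by (intro mult_left_le_one_le) (auto simp: field_simps)
  finally show ?thesis by (simp add: algebra_simps)
qed

text \<open>
  The sufficient decrease bounds the term \<open>\<eta>\<^sup>2 * (norm v)\<^sup>2\<close> of the expanded square by \<open>2 * \<eta>\<close>
  times the drop of \<open>f\<close>, which replaces the gap at \<open>x\<close> supplied by strong convexity by the gap at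
  the new point.
\<close>
lemma gradient_step_contraction:
  fixes f :: "'a::euclidean_space \<Rightarrow> real"
  assumes sc: "v \<bullet> (u - x) + \<mu> / 2 * (norm (u - x))\<^sup>2 \<le> f u - f x"
    and dec: "f (x - \<eta> *\<^sub>R v) \<le> f x - \<eta> / 2 * (norm v)\<^sup>2"
    and \<eta>: "0 < \<eta>"
  shows "(norm (x - \<eta> *\<^sub>R v - u))\<^sup>2
    \<le> (1 - \<eta> * \<mu>) * (norm (x - u))\<^sup>2 - 2 * \<eta> * (f (x - \<eta> *\<^sub>R v) - f u)"
proof -
  have "x - \<eta> *\<^sub>R v - u = (x - u) - \<eta> *\<^sub>R v" by simp
  then have "(norm (x - \<eta> *\<^sub>R v - u))\<^sup>2
      = (norm (x - u))\<^sup>2 + 2 * \<eta> * (v \<bullet> (u - x)) + \<eta>\<^sup>2 * (norm v)\<^sup>2"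
    by (simp only: power2_norm_eq_inner)
      (simp add: inner_diff_left inner_diff_right inner_commute power2_eq_square algebra_simps)
  moreover have "2 * \<eta> * (v \<bullet> (u - x) + \<mu> / 2 * (norm (x - u))\<^sup>2) \<le> 2 * \<eta> * (f u - f x)"
    using sc \<eta> by (intro mult_left_mono) (auto simp: norm_minus_commute)
  moreover have "2 * \<eta> * f (x - \<eta> *\<^sub>R v) \<le> 2 * \<eta> * (f x - \<eta> / 2 * (norm v)\<^sup>2)"
    using dec \<eta> by (intro mult_left_mono) auto
  ultimately show ?thesis by (simp add: algebra_simps power2_eq_square)
qed

section \<open>Accumulating the steps\<close>

text \<open>
  The factor \<open>1 - q ^ T\<close> is \<open>1 - q\<close> times the geometric sum of the weights that unrolling puts in
  front of the gaps; since the gaps do not increase, all of them may be replaced by the last.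
\<close>
lemma gap_bound_of_contraction:
  fixes d \<delta> :: "nat \<Rightarrow> real"
  assumes rec: "\<And>t. d (Suc t) \<le> (1 - \<eta> * \<mu>) * d t - 2 * \<eta> * \<delta> (Suc t)"
    and anti: "\<And>t. \<delta> (Suc t) \<le> \<delta> t"
    and nonneg: "\<And>t. 0 \<le> d t"
    and \<mu>: "\<mu> > 0" and \<eta>: "\<eta> > 0" "\<eta> * \<mu> \<le> 1" and T: "T \<ge> 1"
  shows "\<delta> T \<le> \<mu> * (1 - \<eta> * \<mu>) ^ T / (2 * (1 - (1 - \<eta> * \<mu>) ^ T)) * d 0"
proof -
  define q where "q = 1 - \<eta> * \<mu>"
  have q: "0 \<le> q" "q < 1" using \<mu> \<eta> by (auto simp: q_def)
  have "\<mu> * d n + 2 * \<delta> n * (1 - q ^ n) \<le> \<mu> * (q ^ n * d 0)" for n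
  proof (induction n)
    case 0
    show ?case by simp
  next
    case (Suc n)
    have "\<mu> * d (Suc n) \<le> \<mu> * (q * d n - 2 * \<eta> * \<delta> (Suc n))"
      using rec[of n] \<mu> by (simp add: q_def)
    also have "\<dots> = q * (\<mu> * d n) - 2 * (1 - q) * \<delta> (Suc n)"
      by (simp add: q_def algebra_simps)
    finally have "\<mu> * d (Suc n) + 2 * \<delta> (Suc n) * (1 - q ^ Suc n)
        \<le> q * (\<mu> * d n) + \<delta> (Suc n) * (2 * q * (1 - q ^ n))"
      by (simp add: algebra_simps)
    also have "\<dots> \<le> q * (\<mu> * d n) + \<delta> n * (2 * q * (1 - q ^ n))"
      using q anti[of n] by (intro add_left_mono mult_right_mono) (auto simp: power_le_one)
    also have "\<dots> = q * (\<mu> * d n + 2 * \<delta> n * (1 - q ^ n))"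
      by (simp add: algebra_simps)
    also have "\<dots> \<le> q * (\<mu> * (q ^ n * d 0))"
      using Suc.IH q(1) by (rule mult_left_mono)
    finally show ?case by (simp add: algebra_simps)
  qed
  from this[of T] have "2 * \<delta> T * (1 - q ^ T) \<le> \<mu> * (q ^ T * d 0)"
    using mult_nonneg_nonneg[OF less_imp_le[OF \<mu>] nonneg[of T]] by linarith
  moreover have "q ^ T < 1" using q T by (simp add: power_less_one_iff)
  ultimately show ?thesis unfolding q_def[symmetric] by (simp add: field_simps)
qed

text \<open>
  Adding strong convexity in both directions makes the gradient \<open>\<mu>\<close>-strongly monotone; the
  comparison needs two distinct points, which a ball of positive radius provides. Together with
  \<open>\<eta> \<le> 1 / L\<close> this gives \<open>\<eta> * \<mu> \<le> 1\<close>, so that the contraction factor is non-negative.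
\<close>
lemma strong_convexity_le_lipschitz:
  fixes f :: "'a::euclidean_space \<Rightarrow> real"
  assumes lip: "L-lipschitz_on (cball x R) g" and R: "R > 0"
    and sc: "\<And>u v. u \<in> cball x R \<Longrightarrow> v \<in> cball x R \<Longrightarrow>
      g u \<bullet> (v - u) + \<mu> / 2 * (norm (v - u))\<^sup>2 \<le> f v - f u"
  shows "\<mu> \<le> L"
proof -
  obtain b :: 'a where b: "norm b = R"
    using vector_choose_size[of R] R by auto
  define y where "y = x + b"
  have xB: "x \<in> cball x R" and yB: "y \<in> cball x R"
    using R b by (auto simp: y_def dist_norm)
  have "g x \<bullet> b + \<mu> / 2 * R\<^sup>2 \<le> f y - f x" "- (g y \<bullet> b) + \<mu> / 2 * R\<^sup>2 \<le> f x - f y"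
    using sc[OF xB yB] sc[OF yB xB] b by (simp_all add: y_def)
  then have "\<mu> * R\<^sup>2 \<le> (g y - g x) \<bullet> b"
    by (simp add: inner_diff_left)
  also have "\<dots> \<le> norm (g y - g x) * norm b"
    by (rule norm_cauchy_schwarz)
  also have "\<dots> \<le> (L * R) * R"
    using lipschitz_onD[OF lip yB xB] b R by (simp add: dist_norm y_def)
  finally show ?thesis using R by (simp add: power2_eq_square)
qed

section \<open>Gradient descent on smooth strongly convex functions\<close>

theorem theorem4p3:
  fixes X :: "'a::euclidean_space set"
    and f :: "'a \<Rightarrow> real"
    and r l :: "real \<Rightarrow> real"
    and xstar :: 'a
    and x :: "nat \<Rightarrow> 'a"
    and \<mu> \<eta> fstar G L :: real
  assumes open_X: "open X"
    and f_diff: "\<forall>x\<in>X. f differentiable (at x)"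
    and f_closed: "\<forall>a. closed {x \<in> X. f x \<le> a}"
    and fstar: "fstar = (INF x\<in>X. f x)"
    and f_bdd: "bdd_below (f ` X)"
    and xstar: "xstar \<in> X" "f xstar = fstar"
    and r: "continuous_on {0..} r" "antimono_on {0..} r" "\<forall>u\<ge>0. r u > 0"
    and l: "continuous_on {0..} l" "mono_on {0..} l" "\<forall>u\<ge>0. l u > 0"
    and \<mu>_pos: "\<mu> > 0"
    and f_sc: "strongly_convex_on \<mu> X f"
    and f_smooth: "rl_smooth_on r l X f"
    and x_0: "x 0 \<in> X"
    and G: "G = norm (grad f (x 0))"
    and L: "L = l G"
    and \<eta>: "0 < \<eta>" "\<eta> \<le> 1 / L" "G \<noteq> 0 \<Longrightarrow> \<eta> \<le> r G / (2 * G)"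
    and x_Suc: "\<forall>t. x (Suc t) = x t - \<eta> *\<^sub>R grad f (x t)"
  shows "(\<forall>t. x t \<in> X \<and> norm (grad f (x t)) \<le> G) \<and>
    (\<forall>T\<ge>1. f (x T) - fstar
       \<le> \<mu> * (1 - \<eta> * \<mu>) ^ T / (2 * (1 - (1 - \<eta> * \<mu>) ^ T)) * (norm (x 0 - xstar))\<^sup>2)"
proof -
  define g where "g = grad f"
  have G0: "0 \<le> G" and Lpos: "L > 0" using G L l(3) by auto
  have step: "x (Suc t) = x t - \<eta> *\<^sub>R g (x t)" for t
    using x_Suc by (simp add: g_def)
  have deriv: "GDERIV f u :> g u" if "u \<in> X" for u
    using f_diff that by (simp add: g_def GDERIV_grad)
  have sc: "g u \<bullet> (v - u) + \<mu> / 2 * (norm (v - u))\<^sup>2 \<le> f v - f u" if "u \<in> X" "v \<in> X" for u v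
    using f_sc that by (auto simp: strongly_convex_on_def g_def)
  have conv: "g u \<bullet> (v - u) \<le> f v - f u" if "u \<in> X" "v \<in> X" for u v
    using sc[OF that] \<mu>_pos by (smt (verit) divide_nonneg_nonneg mult_nonneg_nonneg zero_le_power2)
  have ball: "cball u (r (norm (g u))) \<subseteq> X" if "u \<in> X" for u
    using f_smooth that by (auto simp: rl_smooth_on_def g_def)
  have lip: "L-lipschitz_on (cball u (r (norm (g u)))) g" if u: "u \<in> X" "norm (g u) \<le> G" for u
  proof (rule lipschitz_onI)
    fix a b assume ab: "a \<in> cball u (r (norm (g u)))" "b \<in> cball u (r (norm (g u)))"
    have "dist (g a) (g b) \<le> l (norm (g u)) * dist a b"
      using f_smooth u(1) ab unfolding rl_smooth_on_def g_def dist_norm by blast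
    also have "\<dots> \<le> L * dist a b"
      using monotone_onD[OF l(2), of "norm (g u)" G] u(2) G0 by (simp add: L mult_right_mono)
    finally show "dist (g a) (g b) \<le> L * dist a b" .
  qed (use Lpos in simp)
  have radius: "\<eta> * norm (g u) \<le> r (norm (g u)) / 2" if "norm (g u) \<le> G" for u
  proof (cases "G = 0")
    case True
    then have "g u = 0" using that by simp
    then show ?thesis using r(3) by (simp add: less_imp_le)
  next
    case False
    have "\<eta> * norm (g u) \<le> \<eta> * G" using that \<eta>(1) by simp
    also have "\<dots> \<le> r G / 2" using \<eta>(3)[OF False] False G0 by (simp add: field_simps)
    also have "\<dots> \<le> r (norm (g u)) / 2"
      using monotone_onD[OF r(2), of "norm (g u)" G] that G0 by simp
    finally show ?thesis .
  qed
  have next_in_ball: "u - \<eta> *\<^sub>R g u \<in> cball u (r (norm (g u)))" if "norm (g u) \<le> G" for u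
  proof -
    have "r (norm (g u)) > 0" using r(3) by simp
    then show ?thesis using radius[OF that] \<eta>(1) by (simp add: dist_norm)
  qed
  have inv: "x t \<in> X \<and> norm (g (x t)) \<le> G" for t
  proof (induction t)
    case 0
    show ?case using x_0 G by (simp add: g_def)
  next
    case (Suc t)
    then have xt: "x t \<in> X" "norm (g (x t)) \<le> G" by auto
    have "norm (g (x t - \<eta> *\<^sub>R g (x t))) \<le> norm (g (x t))"
      using ball[OF xt(1)] deriv conv
      by (intro gradient_step_norm_le[OF lip[OF xt] Lpos _ _ \<eta>(1,2) radius[OF xt(2)]]) blast+
    then show ?case
      using next_in_ball[OF xt(2)] ball[OF xt(1)] xt(2) step[of t] by auto
  qed
  have dec: "f (x t - \<eta> *\<^sub>R g (x t)) \<le> f (x t) - \<eta> / 2 * (norm (g (x t)))\<^sup>2" for t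
  proof -
    have xt: "x t \<in> X" "norm (g (x t)) \<le> G" using inv[of t] by auto
    have "x t \<in> cball (x t) (r (norm (g (x t))))"
      using r(3) by (simp add: less_imp_le)
    then show ?thesis
      using ball[OF xt(1)] deriv next_in_ball[OF xt(2)]
      by (intro gradient_step_decrease[OF convex_cball lip[OF xt] Lpos _ \<eta>(1,2)]) blast+
  qed
  have "\<mu> \<le> L"
  proof (rule strong_convexity_le_lipschitz)
    show "L-lipschitz_on (cball (x 0) (r (norm (g (x 0))))) g"
      using lip inv[of 0] by blast
    show "r (norm (g (x 0))) > 0" using r(3) by simp
    show "g u \<bullet> (v - u) + \<mu> / 2 * (norm (v - u))\<^sup>2 \<le> f v - f u"
      if "u \<in> cball (x 0) (r (norm (g (x 0))))" "v \<in> cball (x 0) (r (norm (g (x 0))))" for u v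
      using sc ball[OF x_0] that by blast
  qed
  then have "\<eta> * \<mu> \<le> \<eta> * L" using \<eta>(1) by simp
  also have "\<dots> \<le> 1" using \<eta>(2) Lpos by (simp add: pos_le_divide_eq)
  finally have \<eta>\<mu>: "\<eta> * \<mu> \<le> 1" .
  have "f (x T) - fstar
      \<le> \<mu> * (1 - \<eta> * \<mu>) ^ T / (2 * (1 - (1 - \<eta> * \<mu>) ^ T)) * (norm (x 0 - xstar))\<^sup>2"
    if "T \<ge> 1" for T
  proof (rule gap_bound_of_contraction[where d = "\<lambda>t. (norm (x t - xstar))\<^sup>2"
        and \<delta> = "\<lambda>t. f (x t) - fstar", OF _ _ _ \<mu>_pos \<eta>(1) \<eta>\<mu> that])
    show "(norm (x (Suc t) - xstar))\<^sup>2
        \<le> (1 - \<eta> * \<mu>) * (norm (x t - xstar))\<^sup>2 - 2 * \<eta> * (f (x (Suc t)) - fstar)" for t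
      using gradient_step_contraction[OF sc dec \<eta>(1), of t xstar] inv[of t] xstar
      by (simp add: step)
    have "0 \<le> \<eta> / 2 * (norm (g (x t)))\<^sup>2" for t using \<eta>(1) by simp
    then show "f (x (Suc t)) - fstar \<le> f (x t) - fstar" for t
      using dec[of t] unfolding step[of t] by (smt (verit))
  qed simp
  then show ?thesis using inv by (simp add: g_def)
qed

end
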